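(* For every integer $n\ge 2$, $$\mathrm{ex}(n,C_3,2)=4\cdot \mathrm{ex}(n,C_3)=4\cdot\left\lfloor \frac{n^2}{4}\right\rfloor .$$
   Context: All graphs are finite and simple; $C_3$ is the triangle and $\mathrm{ex}(n,F)$ is the ordinary Turán number, the maximum number of edges of an $n$-vertex graph with no subgraph isomorphic to $F$. Let $n,q\ge 1$ be integers. For $\mathbf{x}\in\{0,1,\dots,q\}^n$ the support is $S_{\mathbf{x}}=\{i: x_i\neq 0\}$. Let $Q(n,2)=\{\mathbf{x}\in\{0,1,\dots,q\}^n: |S_{\mathbf{x}}|=2\}$; its elements are called $q$-edges, and a $q$-graph on $n$ vertices is a subset $H\subseteq Q(n,2)$. For a graph $F$ without isolated vertices and an integer $s\ge1$, a $q$-graph $H$ is an $s$-copy of $F$ if $|H|=|E(F)|$ and there is an isomorphism $\iota$ from $F$ to the graph with vertex set $\bigcup_{\mathbf{x}\in H}S_{\mathbf{x}}$ and edge set $\{S_{\mathbf{x}}:\mathbf{x}\in H\}$ such that, writing $\mathbf{x}^e$ for the unique element of $H$ with support $\iota(e)$, for all distinct $e,e'\in E(F)$ and $v\in e\cap e'$ we have $x^{e}_{\iota(v)}+x^{e'}_{\iota(v)}\ge s$. A $q$-graph contains an $s$-copy of $F$ if some subset of it is an $s$-copy of $F$. $\mathrm{ex}(n,F,q)$ is the maximum of $|H|$ over all $H\subseteq Q(n,2)$ containing no $(q+1)$-copy of $F$ (here $q=2$). *)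

theory Defs
  imports Main
begin

datatype 'a graph = Graph (verts: "'a set") (edges: "'a set set")

definition simple_graph :: "'a graph \<Rightarrow> bool" where
  "simple_graph G \<longleftrightarrow>
     finite (verts G) \<and> (\<forall>e\<in>edges G. e \<subseteq> verts G \<and> card e = 2)"

definition subgraph :: "'a graph \<Rightarrow> 'a graph \<Rightarrow> bool" where
  "subgraph G' G \<longleftrightarrow>
     simple_graph G' \<and> verts G' \<subseteq> verts G \<and> edges G' \<subseteq> edges G"

definition graph_iso :: "('a \<Rightarrow> 'b) \<Rightarrow> 'a graph \<Rightarrow> 'b graph \<Rightarrow> bool" where
  "graph_iso \<iota> F G \<longleftrightarrow>
     bij_betw \<iota> (verts F) (verts G) \<and> (\<lambda>e. \<iota> ` e) ` edges F = edges G"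

definition contains_graph :: "'b graph \<Rightarrow> 'a graph \<Rightarrow> bool" where
  "contains_graph G F \<longleftrightarrow> (\<exists>G' \<iota>. subgraph G' G \<and> graph_iso \<iota> F G')"

definition C3 :: "nat graph" where
  "C3 = Graph {0, 1, 2} {{0, 1}, {1, 2}, {0, 2}}"

text \<open>Every finite graph has an isomorphic copy on a set of natural numbers, so
  it suffices to range over graphs of type \<open>nat graph\<close>. The maximum is over a finite set,
  which is nonempty as soon as \<open>F\<close> has an edge.\<close>

definition ex :: "nat \<Rightarrow> 'a graph \<Rightarrow> nat" where
  "ex n F = Max {card (edges G) | G :: nat graph.
     simple_graph G \<and> card (verts G) = n \<and> \<not> contains_graph G F}"

text \<open>The elements of \<open>{0,1,\<dots>,q}\<^sup>n\<close> are encoded as functions on all of \<open>nat\<close> that vanish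
  outside the coordinate set \<open>{1..n}\<close>.\<close>

definition qvectors :: "nat \<Rightarrow> nat \<Rightarrow> (nat \<Rightarrow> nat) set" where
  "qvectors n q = {x. (\<forall>i\<in>{1..n}. x i \<le> q) \<and> (\<forall>i. i \<notin> {1..n} \<longrightarrow> x i = 0)}"

definition support :: "(nat \<Rightarrow> nat) \<Rightarrow> nat set" where
  "support x = {i. x i \<noteq> 0}"

definition qedges :: "nat \<Rightarrow> nat \<Rightarrow> (nat \<Rightarrow> nat) set" where
  "qedges n q = {x \<in> qvectors n q. card (support x) = 2}"

definition support_graph :: "(nat \<Rightarrow> nat) set \<Rightarrow> nat graph" where
  "support_graph H = Graph (\<Union>x\<in>H. support x) (support ` H)"

definition qedge_on :: "(nat \<Rightarrow> nat) set \<Rightarrow> nat set \<Rightarrow> (nat \<Rightarrow> nat)" where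
  "qedge_on H S = (THE x. x \<in> H \<and> support x = S)"

text \<open>For simple \<open>F\<close> and finite \<open>H\<close>, the cardinality condition and the isomorphism make
  \<open>support\<close> injective on \<open>H\<close>, so the definite description
  \<open>qedge_on H (\<iota> ` e)\<close> is well defined for every edge \<open>e\<close> of \<open>F\<close>.\<close>

definition is_s_copy :: "nat \<Rightarrow> 'a graph \<Rightarrow> (nat \<Rightarrow> nat) set \<Rightarrow> bool" where
  "is_s_copy s F H \<longleftrightarrow>
     card H = card (edges F) \<and>
     (\<exists>\<iota>. graph_iso \<iota> F (support_graph H) \<and>
        (\<forall>e\<in>edges F. \<forall>e'\<in>edges F. e \<noteq> e' \<longrightarrow>
          (\<forall>v\<in>e \<inter> e'. qedge_on H (\<iota> ` e) (\<iota> v) + qedge_on H (\<iota> ` e') (\<iota> v) \<ge> s)))"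

definition contains_s_copy :: "nat \<Rightarrow> (nat \<Rightarrow> nat) set \<Rightarrow> 'a graph \<Rightarrow> bool" where
  "contains_s_copy s H F \<longleftrightarrow> (\<exists>H'\<subseteq>H. is_s_copy s F H')"

definition ex_q :: "nat \<Rightarrow> 'a graph \<Rightarrow> nat \<Rightarrow> nat" where
  "ex_q n F q = Max {card H | H. H \<subseteq> qedges n q \<and> \<not> contains_s_copy (q + 1) H F}"

end

theory Submission
  imports Defs
begin

text \<open>
  For the lower bound, put all four \<open>2\<close>-edges on every edge of a triangle-free graph: a
  \<open>3\<close>-copy of the triangle projects to a triangle of the graph. Balanced complete
  bipartite graphs have \<open>n\<^sup>2 div 4\<close> edges, so this gives \<open>4 * (n\<^sup>2 div 4)\<close>.

  The upper bound is an induction that deletes two vertices at a time, as in the usual proof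
  of Mantel's theorem. Suppose that some pair \<open>{u, v}\<close> carries at least three
  \<open>2\<close>-edges. Then one of them has value \<open>2\<close> at \<open>u\<close>, and one of them has value \<open>2\<close> at \<open>v\<close>.
  For a further vertex \<open>w\<close>, send the \<open>2\<close>-edge on \<open>{u, w}\<close> with values \<open>(a, c)\<close> to the one
  on \<open>{v, w}\<close> with values \<open>(3 - a, 3 - c)\<close>. If both were present, one of the two
  distinguished \<open>2\<close>-edges on \<open>{u, v}\<close> would complete them to a \<open>3\<close>-copy of the triangle.
  So each \<open>2\<close>-edge on \<open>{u, w}\<close> excludes its own \<open>2\<close>-edge on \<open>{v, w}\<close>, and the
  two pairs carry at most four together (\<open>card_fibres_at_apex_le\<close>). Deleting \<open>u\<close> and \<open>v\<close>
  therefore costs at most \<open>4 + 4 * (n - 2)\<close> \<open>2\<close>-edges, which is exactly the difference of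
  \<open>4 * (n\<^sup>2 div 4)\<close> and \<open>4 * ((n - 2)\<^sup>2 div 4)\<close>. If there is no such pair, every pair
  carries at most two \<open>2\<close>-edges, and \<open>2 * (n choose 2) = n * (n - 1)\<close> is small enough
  (\<open>card_le_if_no_triangle\<close>).

  Mantel's theorem itself follows: replacing each edge of a triangle-free graph by
  its four \<open>2\<close>-edges turns the bound for \<open>2\<close>-graphs into the bound for graphs.
\<close>

section \<open>The 2-edges on a pair of vertices\<close>

definition fibre :: "nat set \<Rightarrow> (nat \<Rightarrow> nat) set" where
  "fibre S = {x. support x = S \<and> (\<forall>i. x i \<le> 2)}"

definition pair_vec :: "nat \<Rightarrow> nat \<Rightarrow> nat \<Rightarrow> nat \<Rightarrow> nat \<Rightarrow> nat" where
  "pair_vec u v a b = (\<lambda>_. 0)(u := a, v := b)"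

lemma pair_vec_simps [simp]:
  "u \<noteq> v \<Longrightarrow> pair_vec u v a b u = a"
  "pair_vec u v a b v = b"
  "i \<noteq> u \<Longrightarrow> i \<noteq> v \<Longrightarrow> pair_vec u v a b i = 0"
  by (simp_all add: pair_vec_def)

lemma fibre_pairD:
  assumes "x \<in> fibre {u, v}"
  shows "x u \<in> {1, 2}" "x v \<in> {1, 2}" "i \<noteq> u \<Longrightarrow> i \<noteq> v \<Longrightarrow> x i = 0"
proof -
  have s: "x i \<noteq> 0 \<longleftrightarrow> i = u \<or> i = v" and le: "x i \<le> 2" for i
    using assms by (auto simp: fibre_def support_def)
  show "x u \<in> {1, 2}" using s[of u] le[of u] by auto
  show "x v \<in> {1, 2}" using s[of v] le[of v] by auto
  show "i \<noteq> u \<Longrightarrow> i \<noteq> v \<Longrightarrow> x i = 0" using s[of i] by auto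
qed

lemma pair_vec_in_fibre:
  assumes "u \<noteq> v" "a \<in> {1, 2}" "b \<in> {1, 2}"
  shows "pair_vec u v a b \<in> fibre {u, v}"
  using assms by (auto simp: fibre_def support_def pair_vec_def)

lemma fibre_pair_ext:
  assumes "x \<in> fibre {u, v}" "y \<in> fibre {u, v}" "x u = y u" "x v = y v"
  shows "x = y"
proof
  fix i show "x i = y i"
    using assms fibre_pairD(3)[OF assms(1), of i] fibre_pairD(3)[OF assms(2), of i]
    by (cases "i = u \<or> i = v") auto
qed

lemma fibre_pair_eq:
  assumes "u \<noteq> v"
  shows "fibre {u, v} = (\<lambda>(a, b). pair_vec u v a b) ` ({1, 2} \<times> {1, 2})"
proof (intro equalityI subsetI)
  fix x assume x: "x \<in> fibre {u, v}"
  note D = fibre_pairD[OF x]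
  have "x = pair_vec u v (x u) (x v)"
    by (rule fibre_pair_ext[OF x]) (use D assms pair_vec_in_fibre in auto)
  then show "x \<in> (\<lambda>(a, b). pair_vec u v a b) ` ({1, 2} \<times> {1, 2})"
    using D(1,2) by (intro image_eqI[of _ _ "(x u, x v)"]) auto
next
  fix x assume "x \<in> (\<lambda>(a, b). pair_vec u v a b) ` ({1, 2} \<times> {1, 2})"
  then obtain a b where "a \<in> {1, 2}" "b \<in> {1, 2}" "x = pair_vec u v a b"
    by fast
  then show "x \<in> fibre {u, v}"
    using pair_vec_in_fibre[OF assms] by simp
qed

lemma card_fibre:
  assumes "card S = 2"
  shows "finite (fibre S)" "card (fibre S) = 4"
proof -
  obtain u v where S: "S = {u, v}" and ne: "u \<noteq> v"
    using assms by (auto simp: card_2_iff)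
  have "inj_on (\<lambda>(a, b). pair_vec u v a b) ({1, 2} \<times> {1, 2})"
    by (rule inj_onI) (use ne in \<open>auto dest: fun_cong[where x = u] fun_cong[where x = v]\<close>)
  then show "finite (fibre S)" "card (fibre S) = 4"
    unfolding S fibre_pair_eq[OF ne] by (auto simp: card_image card_cartesian_product)
qed

lemma disjoint_fibres: "S \<noteq> T \<Longrightarrow> fibre S \<inter> fibre T = {}"
  by (auto simp: fibre_def)

text \<open>Only two \<open>2\<close>-edges on a pair have value \<open>1\<close> at a given end, so a third one must have
  value \<open>2\<close> there.\<close>

lemma ex_value_2_if_card_ge_3:
  assumes "u \<noteq> v" "A \<subseteq> fibre {u, v}" "card A \<ge> 3"
  shows "\<exists>x\<in>A. x u = 2"
proof (rule ccontr)
  assume no: "\<not> (\<exists>x\<in>A. x u = 2)"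
  have "inj_on (\<lambda>x. x v) A"
  proof (rule inj_onI)
    fix x y assume xy: "x \<in> A" "y \<in> A" "x v = y v"
    have "x u = 1" "y u = 1"
      using no xy fibre_pairD(1)[of x u v] fibre_pairD(1)[of y u v] assms(2) by auto
    with xy assms(2) show "x = y"
      by (intro fibre_pair_ext[of x u v]) auto
  qed
  moreover have "(\<lambda>x. x v) ` A \<subseteq> {1, 2}"
    using assms(2) fibre_pairD(2) by blast
  ultimately have "card A \<le> card {1, 2 :: nat}"
    by (intro card_inj_on_le) auto
  with assms(3) show False by simp
qed

section \<open>Triangles in 2-graphs\<close>

definition has_triangle :: "(nat \<Rightarrow> nat) set \<Rightarrow> bool" where
  "has_triangle H \<longleftrightarrow>
     (\<exists>u v w. \<exists>x\<in>H. \<exists>y\<in>H. \<exists>z\<in>H. u \<noteq> v \<and> u \<noteq> w \<and> v \<noteq> w \<and>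
        support x = {u, v} \<and> support y = {u, w} \<and> support z = {v, w} \<and>
        3 \<le> x u + y u \<and> 3 \<le> x v + z v \<and> 3 \<le> y w + z w)"

lemma contains_s_copy_if_has_triangle:
  assumes "has_triangle H"
  shows "contains_s_copy 3 H C3"
proof -
  obtain u v w x y z where
    H: "x \<in> H" "y \<in> H" "z \<in> H" and ne: "u \<noteq> v" "u \<noteq> w" "v \<noteq> w" and
    s: "support x = {u, v}" "support y = {u, w}" "support z = {v, w}" and
    ge: "3 \<le> x u + y u" "3 \<le> x v + z v" "3 \<le> y w + z w"
    using assms unfolding has_triangle_def by blast
  let ?T = "{x, y, z}"
  define f :: "nat \<Rightarrow> nat" where "f = (\<lambda>i. if i = 0 then u else if i = 1 then v else w)"
  have f: "f 0 = u" "f (Suc 0) = v" "f 2 = w"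
    by (simp_all add: f_def)
  have sne: "{u, v} \<noteq> {u, w}" "{u, v} \<noteq> {v, w}" "{u, w} \<noteq> {v, w}"
    using ne by (auto simp: doubleton_eq_iff)
  then have xyz: "x \<noteq> y" "x \<noteq> z" "y \<noteq> z"
    using s by metis+
  have q: "qedge_on ?T {u, v} = x" "qedge_on ?T {u, w} = y" "qedge_on ?T {v, w} = z"
  proof -
    have "qedge_on ?T (support t) = t" if t: "t \<in> ?T" for t
      unfolding qedge_on_def
    proof (rule the_equality)
      show "t' = t" if "t' \<in> ?T \<and> support t' = support t" for t'
        using that t s sne by (metis empty_iff insert_iff)
    qed (use t in simp)
    from this[of x] this[of y] this[of z]
    show "qedge_on ?T {u, v} = x" "qedge_on ?T {u, w} = y" "qedge_on ?T {v, w} = z"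
      by (simp_all only: s insertI1 insertI2 simp_thms)
  qed
  have e: "{0, Suc 0} \<noteq> {Suc 0, 2}" "{0, Suc 0} \<noteq> {0, 2}" "{Suc 0, 2} \<noteq> {0, 2 :: nat}"
    by (auto simp: doubleton_eq_iff)
  have "card ?T = card (edges C3)"
    using xyz e by (simp add: C3_def)
  moreover have "graph_iso f C3 (support_graph ?T)"
  proof -
    have "inj_on f {0, 1, 2}" using ne by (simp add: inj_on_def f)
    moreover have "f ` {0, 1, 2} = {u, v, w}" by (simp add: f)
    moreover have "(\<Union>x\<in>?T. support x) = {u, v, w}" using s by auto
    moreover have "(\<lambda>e. f ` e) ` {{0, 1}, {1, 2}, {0, 2}} = support ` ?T"
      using s by (simp add: f insert_commute)
    ultimately show ?thesis
      by (simp add: graph_iso_def C3_def support_graph_def bij_betw_def)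
  qed
  moreover have "\<forall>e\<in>edges C3. \<forall>e'\<in>edges C3. e \<noteq> e' \<longrightarrow>
      (\<forall>v\<in>e \<inter> e'. qedge_on ?T (f ` e) (f v) + qedge_on ?T (f ` e') (f v) \<ge> 3)"
    using ge by (auto simp: C3_def f q add.commute)
  ultimately have "is_s_copy 3 C3 ?T"
    unfolding is_s_copy_def by blast
  moreover have "?T \<subseteq> H" using H by simp
  ultimately show ?thesis
    unfolding contains_s_copy_def by (intro exI[of _ ?T] conjI)
qed

text \<open>The case analysis in the proof is on the value \<open>a\<close> at \<open>u\<close> of the \<open>2\<close>-edge on \<open>{u, w}\<close>.
  The sum at \<open>w\<close> is always \<open>c + (3 - c) = 3\<close>. If \<open>a = 1\<close>, the \<open>2\<close>-edge on \<open>{v, w}\<close> has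
  value \<open>2\<close> at \<open>v\<close>, and only \<open>u\<close> still needs value \<open>2\<close> on \<open>{u, v}\<close>. If \<open>a = 2\<close>, the
  roles of \<open>u\<close> and \<open>v\<close> are exchanged.\<close>

lemma card_fibres_at_apex_le:
  assumes ne: "u \<noteq> v" "u \<noteq> w" "v \<noteq> w"
    and no: "\<not> has_triangle H"
    and heavy: "card (H \<inter> fibre {u, v}) \<ge> 3"
  shows "card (H \<inter> fibre {u, w}) + card (H \<inter> fibre {v, w}) \<le> 4"
proof -
  define opp where "opp = (\<lambda>y :: nat \<Rightarrow> nat. pair_vec v w (3 - y u) (3 - y w))"
  obtain x1 where x1: "x1 \<in> H" "x1 \<in> fibre {u, v}" "x1 u = 2"
    using ex_value_2_if_card_ge_3[OF ne(1) _ heavy] by blast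
  obtain x2 where x2: "x2 \<in> H" "x2 \<in> fibre {u, v}" "x2 v = 2"
    using ex_value_2_if_card_ge_3[of v u "H \<inter> fibre {u, v}"] ne(1) heavy
    by (auto simp: insert_commute)
  have opp_fibre: "opp y \<in> fibre {v, w}" if "y \<in> fibre {u, w}" for y
    unfolding opp_def
    using fibre_pairD(1,2)[OF that] by (intro pair_vec_in_fibre[OF ne(3)]) auto
  have opp_notin: "opp y \<notin> H" if y: "y \<in> H" "y \<in> fibre {u, w}" for y
  proof
    assume z: "opp y \<in> H"
    note yv = fibre_pairD(1,2)[OF y(2)]
    have zv: "opp y v = 3 - y u" "opp y w = 3 - y w"
      using ne by (simp_all add: opp_def)
    have s: "support y = {u, w}" "support (opp y) = {v, w}"
      "support x1 = {u, v}" "support x2 = {u, v}"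
      using y opp_fibre x1 x2 by (simp_all add: fibre_def)
    have "\<exists>x\<in>H. support x = {u, v} \<and> 3 \<le> x u + y u \<and> 3 \<le> x v + opp y v"
    proof (cases "y u = 1")
      case True
      then show ?thesis
        using x1 s zv fibre_pairD(2)[OF x1(2)] by (intro bexI[of _ x1]) auto
    next
      case False
      then have "y u = 2" using yv by auto
      then show ?thesis
        using x2 s zv fibre_pairD(1)[OF x2(2)] by (intro bexI[of _ x2]) auto
    qed
    moreover have "3 \<le> y w + opp y w"
      using yv zv by auto
    ultimately show False
      using no ne s y(1) z unfolding has_triangle_def by blast
  qed
  have "inj_on opp (H \<inter> fibre {u, w})"
  proof (rule inj_onI)
    fix y y' assume yy: "y \<in> H \<inter> fibre {u, w}" "y' \<in> H \<inter> fibre {u, w}" "opp y = opp y'"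
    have "3 - y u = 3 - y' u" "3 - y w = 3 - y' w"
      using fun_cong[OF yy(3), of v] fun_cong[OF yy(3), of w] ne by (simp_all add: opp_def)
    then show "y = y'"
      using yy fibre_pairD(1,2)[of y u w] fibre_pairD(1,2)[of y' u w]
      by (intro fibre_pair_ext[of y u w]) auto
  qed
  moreover have fin: "finite (fibre {v, w})" and c4: "card (fibre {v, w}) = 4"
    using card_fibre[of "{v, w}"] ne by auto
  moreover have "opp ` (H \<inter> fibre {u, w}) \<subseteq> fibre {v, w} - H \<inter> fibre {v, w}"
    using opp_fibre opp_notin by auto
  ultimately have "card (H \<inter> fibre {u, w}) \<le> card (fibre {v, w} - H \<inter> fibre {v, w})"
    by (intro card_inj_on_le) auto
  also have "\<dots> = 4 - card (H \<inter> fibre {v, w})"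
    using fin c4 by (subst card_Diff_subset) auto
  finally show ?thesis
    using card_mono[OF fin, of "H \<inter> fibre {v, w}"] c4 by simp
qed

section \<open>The upper bound\<close>

text \<open>Vertex sets are arbitrary here because the induction deletes arbitrary vertices.\<close>

definition qedges_in :: "nat set \<Rightarrow> (nat \<Rightarrow> nat) set" where
  "qedges_in V = (\<Union>e\<in>{e. e \<subseteq> V \<and> card e = 2}. fibre e)"

lemma in_qedges_in_iff:
  "x \<in> qedges_in V \<longleftrightarrow> support x \<subseteq> V \<and> card (support x) = 2 \<and> (\<forall>i. x i \<le> 2)"
  unfolding qedges_in_def fibre_def by blast

lemma support_subset_iff: "support x \<subseteq> A \<longleftrightarrow> (\<forall>i. i \<notin> A \<longrightarrow> x i = 0)"
  unfolding support_def subset_iff mem_Collect_eq by metis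

lemma qvectors_iff: "x \<in> qvectors n q \<longleftrightarrow> support x \<subseteq> {1..n} \<and> (\<forall>i. x i \<le> q)"
proof -
  have "x i \<le> q" if "\<forall>i\<in>{1..n}. x i \<le> q" "\<forall>i. i \<notin> {1..n} \<longrightarrow> x i = 0" for i
    using that by (cases "i \<in> {1..n}") (simp_all del: atLeastAtMost_iff)
  then show ?thesis
    unfolding qvectors_def support_subset_iff mem_Collect_eq by (intro iffI conjI allI; simp)
qed

lemma qedges_eq_qedges_in: "qedges n 2 = qedges_in {1..n}"
  by (rule set_eqI) (simp only: qedges_def mem_Collect_eq in_qedges_in_iff qvectors_iff conj_ac)

lemma finite_qedges_in: "finite V \<Longrightarrow> finite (qedges_in V)"
  unfolding qedges_in_def
  by (rule finite_UN_I) (auto simp: card_fibre)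

lemma sq_div_4_step: "(m + 2)\<^sup>2 div 4 = m\<^sup>2 div 4 + m + (1 :: nat)"
proof -
  have "(m + 2)\<^sup>2 = m\<^sup>2 + 4 * (m + 1)"
    by (simp add: power2_eq_square algebra_simps)
  then show ?thesis by simp
qed

lemma half_times_half: "(n div 2) * (n - n div 2) = n\<^sup>2 div (4 :: nat)"
proof (cases "even n")
  case True
  then obtain k where "n = 2 * k" by blast
  then show ?thesis by (simp add: power2_eq_square)
next
  case False
  then obtain k where k: "n = 2 * k + 1" by (blast elim: oddE)
  then have "n\<^sup>2 = 4 * (k * (k + 1)) + 1"
    by (simp add: power2_eq_square algebra_simps)
  then have "n\<^sup>2 div 4 = k * (k + 1)" by simp
  then show ?thesis using k by simp
qed

lemma mult_pred_le_sq_div_4: "n * (n - 1) \<le> 4 * (n\<^sup>2 div (4 :: nat))"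
proof -
  have "n - 1 \<le> 2 * (n div 2)" "n \<le> 2 * (n - n div 2)"
    by linarith+
  then have "(n - 1) * n \<le> 2 * (n div 2) * (2 * (n - n div 2))"
    by (rule mult_le_mono)
  then show ?thesis
    using half_times_half[of n] by (simp add: mult.commute mult.left_commute)
qed

lemma card_le_if_no_triangle:
  assumes "finite V" "H \<subseteq> qedges_in V" "\<not> has_triangle H"
  shows "card H \<le> 4 * ((card V)\<^sup>2 div 4)"
  using assms
proof (induction "card V" arbitrary: V H rule: less_induct)
  case less
  let ?P = "\<lambda>V. {e. e \<subseteq> V \<and> card e = 2} :: nat set set"
  have finP: "finite (?P V)" using less.prems(1) by simp
  show ?case
  proof (cases "\<exists>e\<in>?P V. card (H \<inter> fibre e) \<ge> 3")
    case True
    then obtain e where "e \<subseteq> V" "card e = 2" and heavy: "card (H \<inter> fibre e) \<ge> 3"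
      by blast
    then obtain u v where e: "e = {u, v}" and ne: "u \<noteq> v" and V: "u \<in> V" "v \<in> V"
      by (auto simp: card_2_iff)
    define W where "W = V - {u, v}"
    define H' where "H' = H \<inter> qedges_in W"
    define A where "A = (\<Union>w\<in>W. H \<inter> fibre {u, w} \<union> H \<inter> fibre {v, w})"
    have finW: "finite W" using less.prems(1) by (simp add: W_def)
    have cV: "card V = card W + 2"
    proof -
      have "card {u, v} \<le> card V"
        using V less.prems(1) by (intro card_mono) auto
      moreover have "card W = card V - card {u, v}"
        unfolding W_def using V by (intro card_Diff_subset) auto
      ultimately show ?thesis using ne by simp
    qed
    have cover: "H \<subseteq> (H \<inter> fibre {u, v}) \<union> A \<union> H'"
    proof
      fix x assume xH: "x \<in> H"
      then obtain d where d: "d \<subseteq> V" "card d = 2" "x \<in> fibre d"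
        using less.prems(2) by (auto simp: qedges_in_def)
      then obtain a b where ab: "d = {a, b}" "a \<noteq> b" by (auto simp: card_2_iff)
      show "x \<in> (H \<inter> fibre {u, v}) \<union> A \<union> H'"
      proof (cases "d \<subseteq> W")
        case True
        then show ?thesis using d xH by (auto simp: H'_def qedges_in_def)
      next
        case False
        then have "d = {u, v} \<or> (\<exists>w\<in>W. d = {u, w} \<or> d = {v, w})"
          using d ab by (auto simp: W_def doubleton_eq_iff)
        then show ?thesis using d xH by (auto simp: A_def)
      qed
    qed
    have finH': "finite H'"
      using finite_qedges_in[OF finW] by (simp add: H'_def)
    have cuv: "card (H \<inter> fibre {u, v}) \<le> 4" "finite (H \<inter> fibre {u, v})"
      using card_mono[OF card_fibre(1), of "{u, v}" "H \<inter> fibre {u, v}"]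
        card_fibre[of "{u, v}"] ne by auto
    have cA: "card A \<le> 4 * card W" and finA: "finite A"
    proof -
      have "card (H \<inter> fibre {u, w} \<union> H \<inter> fibre {v, w}) \<le> 4" if "w \<in> W" for w
        using card_Un_le[of "H \<inter> fibre {u, w}" "H \<inter> fibre {v, w}"]
          card_fibres_at_apex_le[of u v w H] ne that heavy less.prems(3)
        unfolding e by (auto simp: W_def)
      then have "(\<Sum>w\<in>W. card (H \<inter> fibre {u, w} \<union> H \<inter> fibre {v, w})) \<le> of_nat (card W) * 4"
        by (intro sum_bounded_above) auto
      then show "card A \<le> 4 * card W"
        unfolding A_def
        using card_UN_le[OF finW, of "\<lambda>w. H \<inter> fibre {u, w} \<union> H \<inter> fibre {v, w}"] by simp
      show "finite A"
        unfolding A_def using finW card_fibre(1) by (auto simp: W_def)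
    qed
    have noT: "\<not> has_triangle H'"
      using less.prems(3) unfolding H'_def has_triangle_def by blast
    have "card H' \<le> 4 * ((card W)\<^sup>2 div 4)"
      by (rule less.hyps) (use cV finW noT in \<open>auto simp: H'_def\<close>)
    moreover have "card H \<le> card (H \<inter> fibre {u, v}) + card A + card H'"
      using card_mono[OF _ cover] finA finH' cuv(2)
        card_Un_le[of "(H \<inter> fibre {u, v}) \<union> A" H'] card_Un_le[of "H \<inter> fibre {u, v}" A]
      by fastforce
    ultimately show ?thesis
      using cuv(1) cA cV sq_div_4_step[of "card W"] by simp
  next
    case False
    have "H = (\<Union>e\<in>?P V. H \<inter> fibre e)"
      using less.prems(2) by (auto simp: qedges_in_def)
    then have "card H \<le> (\<Sum>e\<in>?P V. card (H \<inter> fibre e))"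
      using card_UN_le[OF finP, of "\<lambda>e. H \<inter> fibre e"] by simp
    also have "\<dots> \<le> of_nat (card (?P V)) * 2"
      using False by (intro sum_bounded_above) force
    also have "\<dots> = card V * (card V - 1)"
    proof -
      have "even (card V * (card V - 1))" by (cases "card V") auto
      then show ?thesis
        using n_subsets[OF less.prems(1), of 2] by (simp add: choose_two)
    qed
    also have "\<dots> \<le> 4 * ((card V)\<^sup>2 div 4)"
      by (rule mult_pred_le_sq_div_4)
    finally show ?thesis .
  qed
qed

section \<open>Blowing up a triangle-free graph\<close>

definition blow_up :: "nat graph \<Rightarrow> (nat \<Rightarrow> nat) set" where
  "blow_up G = (\<Union>e\<in>edges G. fibre e)"

lemma finite_edges: "simple_graph G \<Longrightarrow> finite (edges G)"
  unfolding simple_graph_def by (rule finite_subset[of _ "Pow (verts G)"]) auto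

lemma blow_up_subset: "simple_graph G \<Longrightarrow> blow_up G \<subseteq> qedges_in (verts G)"
  by (auto simp: blow_up_def qedges_in_def simple_graph_def)

lemma card_blow_up:
  assumes "simple_graph G"
  shows "card (blow_up G) = 4 * card (edges G)"
proof -
  have c: "card e = 2" if "e \<in> edges G" for e
    using assms that by (simp add: simple_graph_def)
  have "card (blow_up G) = (\<Sum>e\<in>edges G. card (fibre e))"
    unfolding blow_up_def using finite_edges[OF assms] card_fibre(1) c disjoint_fibres
    by (intro card_UN_disjoint) auto
  also have "\<dots> = 4 * card (edges G)"
    using card_fibre(2) c by simp
  finally show ?thesis .
qed

text \<open>Any \<open>s\<close>-copy in the blow-up forgets its values to an ordinary copy in the graph.\<close>

lemma contains_graph_if_blow_up_contains_s_copy: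
  assumes G: "simple_graph G" and "contains_s_copy s (blow_up G) F"
  shows "contains_graph G F"
proof -
  obtain T f where T: "T \<subseteq> blow_up G" and iso: "graph_iso f F (support_graph T)"
    using assms(2) by (auto simp: contains_s_copy_def is_s_copy_def)
  have "support x \<in> edges G" if "x \<in> T" for x
    using T that by (auto simp: blow_up_def fibre_def)
  then have E: "support ` T \<subseteq> edges G" by auto
  have "(\<Union>x\<in>T. support x) \<subseteq> verts G" "\<forall>x\<in>T. card (support x) = 2"
    using E G unfolding simple_graph_def by blast+
  moreover from this have "finite (\<Union>x\<in>T. support x)"
    using G finite_subset unfolding simple_graph_def by blast
  ultimately have "subgraph (support_graph T) G"
    using E by (auto simp: subgraph_def simple_graph_def support_graph_def)
  with iso show ?thesis by (auto simp: contains_graph_def)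
qed

text \<open>Mantel's theorem, read off from the bound for \<open>2\<close>-graphs.\<close>

lemma card_edges_le_if_triangle_free:
  fixes G :: "nat graph"
  assumes "simple_graph G" "\<not> contains_graph G C3"
  shows "card (edges G) \<le> (card (verts G))\<^sup>2 div 4"
proof -
  have "\<not> has_triangle (blow_up G)"
    using assms contains_s_copy_if_has_triangle contains_graph_if_blow_up_contains_s_copy
    by blast
  moreover have "finite (verts G)" using assms(1) by (simp add: simple_graph_def)
  ultimately have "card (blow_up G) \<le> 4 * ((card (verts G))\<^sup>2 div 4)"
    using blow_up_subset[OF assms(1)] by (intro card_le_if_no_triangle)
  then show ?thesis by (simp add: card_blow_up[OF assms(1)])
qed

section \<open>Balanced complete bipartite graphs\<close>

definition turan_graph2 :: "nat \<Rightarrow> nat graph" where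
  "turan_graph2 n =
     Graph {1..n} ((\<lambda>(a, b). {a, b}) ` ({1..n div 2} \<times> {n div 2 + 1..n}))"

lemma simple_turan_graph2: "simple_graph (turan_graph2 n)"
  by (auto simp: simple_graph_def turan_graph2_def card_insert_if)

lemma card_edges_turan_graph2: "card (edges (turan_graph2 n)) = n\<^sup>2 div 4"
proof -
  have "inj_on (\<lambda>(a, b). {a, b}) ({1..n div 2} \<times> {n div 2 + 1..n})"
    by (rule inj_onI) (clarsimp simp: doubleton_eq_iff)
  then have "card (edges (turan_graph2 n)) = (n div 2) * (n - n div 2)"
    unfolding turan_graph2_def by (simp add: card_image card_cartesian_product)
  then show ?thesis
    by (simp only: half_times_half)
qed

text \<open>Each edge joins a vertex \<open>\<le> n div 2\<close> to a vertex beyond, which is a proper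
  \<open>2\<close>-colouring; among three vertices two would share their colour.\<close>

lemma triangle_free_turan_graph2: "\<not> contains_graph (turan_graph2 n) C3"
proof
  assume "contains_graph (turan_graph2 n) C3"
  then obtain f G' where "subgraph G' (turan_graph2 n)" "graph_iso f C3 G'"
    by (auto simp: contains_graph_def)
  then have "(\<lambda>e. f ` e) ` edges C3 \<subseteq> edges (turan_graph2 n)"
    by (simp add: subgraph_def graph_iso_def)
  then have E: "{f 0, f 1} \<in> edges (turan_graph2 n)" "{f 1, f 2} \<in> edges (turan_graph2 n)"
      "{f 0, f 2} \<in> edges (turan_graph2 n)"
    by (simp_all add: C3_def)
  have col: "(a \<le> n div 2) \<noteq> (b \<le> n div 2)" if "{a, b} \<in> edges (turan_graph2 n)" for a b
    using that by (auto simp: turan_graph2_def doubleton_eq_iff)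
  show False
    using col[OF E(1)] col[OF E(2)] col[OF E(3)] by blast
qed

section \<open>The two extremal numbers\<close>

lemma Max_nat_eqI:
  assumes "m \<in> S" "\<And>k. k \<in> S \<Longrightarrow> k \<le> m"
  shows "Max S = (m :: nat)"
  using assms by (intro Max_eqI) (auto intro: finite_subset[of S "{..m}"])

lemma ex_C3: "ex n C3 = n\<^sup>2 div 4"
  unfolding ex_def
proof (rule Max_nat_eqI)
  have "card (verts (turan_graph2 n)) = n" by (simp add: turan_graph2_def)
  then show "n\<^sup>2 div 4 \<in> {card (edges G) | G :: nat graph.
      simple_graph G \<and> card (verts G) = n \<and> \<not> contains_graph G C3}"
    by (intro CollectI exI[of _ "turan_graph2 n"])
      (simp add: simple_turan_graph2 triangle_free_turan_graph2 card_edges_turan_graph2)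
next
  fix k
  assume "k \<in> {card (edges G) | G :: nat graph.
      simple_graph G \<and> card (verts G) = n \<and> \<not> contains_graph G C3}"
  then obtain G :: "nat graph" where "k = card (edges G)" "simple_graph G"
      "card (verts G) = n" "\<not> contains_graph G C3"
    by blast
  then show "k \<le> n\<^sup>2 div 4"
    using card_edges_le_if_triangle_free[of G] by simp
qed

lemma ex_q_C3: "ex_q n C3 2 = 4 * (n\<^sup>2 div 4)"
  unfolding ex_q_def
proof (rule Max_nat_eqI)
  let ?H = "blow_up (turan_graph2 n)"
  have "?H \<subseteq> qedges n 2"
    using blow_up_subset[OF simple_turan_graph2]
    by (simp add: qedges_eq_qedges_in turan_graph2_def)
  moreover have "\<not> contains_s_copy (2 + 1) ?H C3"
    using contains_graph_if_blow_up_contains_s_copy[OF simple_turan_graph2]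
      triangle_free_turan_graph2 by blast
  moreover have "card ?H = 4 * (n\<^sup>2 div 4)"
    by (simp add: card_blow_up simple_turan_graph2 card_edges_turan_graph2)
  ultimately show "4 * (n\<^sup>2 div 4)
      \<in> {card H | H. H \<subseteq> qedges n 2 \<and> \<not> contains_s_copy (2 + 1) H C3}"
    by (intro CollectI exI[of _ ?H]) simp
next
  fix k assume "k \<in> {card H | H. H \<subseteq> qedges n 2 \<and> \<not> contains_s_copy (2 + 1) H C3}"
  then obtain H where H: "k = card H" "H \<subseteq> qedges_in {1..n}" "\<not> contains_s_copy 3 H C3"
    by (auto simp: qedges_eq_qedges_in)
  then have "\<not> has_triangle H"
    using contains_s_copy_if_has_triangle by blast
  with H show "k \<le> 4 * (n\<^sup>2 div 4)"
    using card_le_if_no_triangle[of "{1..n}" H] by simp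
qed

theorem theorem1p7:
  fixes n :: nat
  assumes "n \<ge> 2"
  shows "ex_q n C3 2 = 4 * ex n C3 \<and> 4 * ex n C3 = 4 * (n\<^sup>2 div 4)"
  by (simp add: ex_C3 ex_q_C3)

end
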